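(* Let $G$ be a connected and locally path connected topological group with identity element $e_G$, and let $H\leqslant\pi_1(G,e_G)$ be a subgroup. Then the following statements are equivalent: (i) $H$ is a closed subgroup of $\pi_1^{qtop}(G,e_G)$. (ii) $H$ is a closed subgroup of $\pi_1^{wh}(G,e_G)$. (iii) $G$ is homotopically Hausdorff relative to $H$. (iv) $G$ is homotopically path Hausdorff relative to $H$.
   Context: For a pointed space $(X,x_0)$, $\pi_1^{qtop}(X,x_0)$ denotes the fundamental group $\pi_1(X,x_0)$ with the quotient topology induced by the natural surjection $\Omega(X,x_0)\to\pi_1(X,x_0)$, where $\Omega(X,x_0)$ is the space of loops in $X$ based at $x_0$ with the compact-open topology. $\pi_1^{wh}(X,x_0)$ denotes $\pi_1(X,x_0)$ with the whisker topology, which has as a basis all sets $[\alpha]i_*\pi_1(U,x_0)=\{[\beta]\in\pi_1(X,x_0)\mid \beta\simeq\alpha*\delta \text{ rel } \{0,1\}\text{ for some loop }\delta\text{ in }U\text{ based at }x_0\}$, where $[\alpha]\in\pi_1(X,x_0)$ and $U$ is an open neighborhood of $x_0$. Let $P(X,x_0)$ be the set of paths in $X$ starting at $x_0$, let $*$ denote concatenation of paths and let $\bar\alpha$ denote the reverse of a path $\alpha$. Let $H\leq\pi_1(X,x_0)$. $X$ is homotopically Hausdorff relative to $H$ if for every $x\in X$, every $\alpha\in P(X,x_0)$ with $\alpha(1)=x$, and every $g\in\pi_1(X,x_0)\setminus H$, there is an open neighborhood $U_g$ of $\alpha(1)$ such that there is no loop $\gamma$ in $U_g$ based at $\alpha(1)$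 with $[\alpha*\gamma*\bar\alpha]\in Hg$, where $Hg$ is the right coset of $H$ with respect to $g$. $X$ is homotopically path Hausdorff relative to $H$ if for every pair of paths $\alpha,\beta\in P(X,x_0)$ with $\alpha(1)=\beta(1)$ and $[\alpha*\bar\beta]\notin H$, there is a partition $0=t_0<t_1<\dots<t_n=1$ and a sequence of open subsets $U_1,\dots,U_n$ of $X$ with $\alpha([t_{i-1},t_i])\subseteq U_i$ for $1\le i\le n$, such that if $\gamma:[0,1]\to X$ is another path satisfying $\gamma([t_{i-1},t_i])\subseteq U_i$ for $1\le i\le n$ and $\gamma(t_i)=\alpha(t_i)$ for every $0\le i\le n$, then $[\gamma*\bar\beta]\notin H$. *)

theory Defs
  imports "HOL-Analysis.Analysis" "HOL-Algebra.Coset"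
begin

section \<open>Loops, path classes and the fundamental group\<close>

text \<open>
  As usual in HOL-Analysis, a path is a function on the reals of which only the restriction to
  the unit interval matters, and a space \<open>X\<close> is a type of class \<open>topological_space\<close>.
\<close>

definition loops_at :: "'a::topological_space \<Rightarrow> (real \<Rightarrow> 'a) set" where
  "loops_at x = {p. path p \<and> pathstart p = x \<and> pathfinish p = x}"

definition paths_from :: "'a::topological_space \<Rightarrow> (real \<Rightarrow> 'a) set" where
  "paths_from x = {p. path p \<and> pathstart p = x}"

text \<open>Homotopies of paths are relative to the endpoints.\<close>

definition path_class :: "(real \<Rightarrow> 'a::topological_space) \<Rightarrow> (real \<Rightarrow> 'a) set" where
  "path_class p = {q. homotopic_paths UNIV p q}"

definition fundamental_group ::
  "'a::topological_space \<Rightarrow> (real \<Rightarrow> 'a) set monoid" where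
  "fundamental_group x =
    \<lparr>carrier = path_class ` loops_at x,
     mult = (\<lambda>A B. \<Union>p\<in>A. \<Union>q\<in>B. path_class (p +++ q)),
     one = path_class (\<lambda>_. x)\<rparr>"

lemma path_class_eq_iff:
  assumes "path p" "path q"
  shows "path_class p = path_class q \<longleftrightarrow> homotopic_paths UNIV p q"
proof
  assume "path_class p = path_class q"
  moreover have "q \<in> path_class q"
    using assms by (simp add: path_class_def)
  ultimately have "q \<in> path_class p"
    by simp
  then show "homotopic_paths UNIV p q"
    by (simp add: path_class_def)
next
  assume "homotopic_paths UNIV p q"
  then show "path_class p = path_class q"
    unfolding path_class_def
    using homotopic_paths_sym homotopic_paths_trans by blast
qed

lemma path_class_mult:
  assumes "p \<in> loops_at x" "q \<in> loops_at x"
  shows "path_class p \<otimes>\<^bsub>fundamental_group x\<^esub> path_class q = path_class (p +++ q)"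
proof -
  have *: "path_class (p' +++ q') = path_class (p +++ q)"
    if "p' \<in> path_class p" "q' \<in> path_class q" for p' q'
  proof -
    have h: "homotopic_paths UNIV p p'" "homotopic_paths UNIV q q'"
      using that by (auto simp: path_class_def)
    have "homotopic_paths UNIV (p +++ q) (p' +++ q')"
      by (rule homotopic_paths_join[OF h]) (use assms in \<open>auto simp: loops_at_def\<close>)
    then show ?thesis
      using path_class_eq_iff homotopic_paths_imp_path by metis
  qed
  have "p \<in> path_class p" "q \<in> path_class q"
    using assms by (auto simp: path_class_def loops_at_def)
  then have "(\<Union>p'\<in>path_class p. \<Union>q'\<in>path_class q. path_class (p' +++ q')) = path_class (p +++ q)"
    using * by blast
  then show ?thesis
    by (simp add: fundamental_group_def)
qed

lemma loops_at_join: "p \<in> loops_at x \<Longrightarrow> q \<in> loops_at x \<Longrightarrow> p +++ q \<in> loops_at x"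
  by (auto simp: loops_at_def)

lemma loops_at_reverse: "p \<in> loops_at x \<Longrightarrow> reversepath p \<in> loops_at x"
  by (auto simp: loops_at_def)

lemma loops_at_const: "(\<lambda>_. x) \<in> loops_at x"
  by (auto simp: loops_at_def path_def pathstart_def pathfinish_def)

text \<open>
  The unit and inverse laws are stated in the library only for normed vector spaces; they are
  transferred from the unit interval by composition with the path.
\<close>

lemma homotopic_paths_const_right:
  fixes p :: "real \<Rightarrow> 'a::topological_space"
  assumes "path p"
  shows "homotopic_paths UNIV (p +++ (\<lambda>_. pathfinish p)) p"
proof -
  let ?i = "linepath 0 1 :: real \<Rightarrow> real"
  have "homotopic_paths {0..1} (?i +++ linepath 1 1) ?i"
    by (rule homotopic_paths_rid') (auto simp: closed_segment_eq_real_ivl)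
  then have "homotopic_paths UNIV (p \<circ> (?i +++ linepath 1 1)) (p \<circ> ?i)"
    by (rule homotopic_paths_continuous_image) (use assms in \<open>auto simp: path_def\<close>)
  moreover have "p \<circ> ?i = p" "p \<circ> (?i +++ linepath 1 1) = p +++ (\<lambda>_. pathfinish p)"
    by (auto simp: fun_eq_iff linepath_def joinpaths_def pathfinish_def)
  ultimately show ?thesis by simp
qed

lemma homotopic_paths_const_left:
  fixes p :: "real \<Rightarrow> 'a::topological_space"
  assumes "path p"
  shows "homotopic_paths UNIV ((\<lambda>_. pathstart p) +++ p) p"
proof -
  let ?i = "linepath 0 1 :: real \<Rightarrow> real"
  have "homotopic_paths {0..1} (linepath 0 0 +++ ?i) ?i"
    by (rule homotopic_paths_lid') (auto simp: closed_segment_eq_real_ivl)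
  then have "homotopic_paths UNIV (p \<circ> (linepath 0 0 +++ ?i)) (p \<circ> ?i)"
    by (rule homotopic_paths_continuous_image) (use assms in \<open>auto simp: path_def\<close>)
  moreover have "p \<circ> ?i = p" "p \<circ> (linepath 0 0 +++ ?i) = (\<lambda>_. pathstart p) +++ p"
    by (auto simp: fun_eq_iff linepath_def joinpaths_def pathstart_def)
  ultimately show ?thesis by simp
qed

lemma homotopic_paths_reverse_left:
  fixes p :: "real \<Rightarrow> 'a::topological_space"
  assumes "path p"
  shows "homotopic_paths UNIV (reversepath p +++ p) (\<lambda>_. pathfinish p)"
proof -
  let ?i = "linepath 0 1 :: real \<Rightarrow> real"
  have "homotopic_paths {0..1} (reversepath ?i +++ ?i) (linepath (pathfinish ?i) (pathfinish ?i))"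
    by (rule homotopic_paths_linv) (auto simp: closed_segment_eq_real_ivl)
  then have "homotopic_paths UNIV (p \<circ> (reversepath ?i +++ ?i))
               (p \<circ> (linepath (pathfinish ?i) (pathfinish ?i)))"
    by (rule homotopic_paths_continuous_image) (use assms in \<open>auto simp: path_def\<close>)
  moreover have "p \<circ> (linepath (pathfinish ?i) (pathfinish ?i)) = (\<lambda>_. pathfinish p)"
    "p \<circ> (reversepath ?i +++ ?i) = reversepath p +++ p"
    by (auto simp: fun_eq_iff linepath_def joinpaths_def pathfinish_def reversepath_def)
  ultimately show ?thesis by simp
qed

lemma group_fundamental_group: "Group.group (fundamental_group x)"
proof (rule groupI)
  let ?G = "fundamental_group x"
  have car: "carrier ?G = path_class ` loops_at x"
    and one: "\<one>\<^bsub>?G\<^esub> = path_class (\<lambda>_. x)"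
    by (auto simp: fundamental_group_def)
  have path: "path p" if "p \<in> loops_at x" for p
    using that by (auto simp: loops_at_def)
  show "\<one>\<^bsub>?G\<^esub> \<in> carrier ?G"
    by (auto simp: car one loops_at_const)
  show "A \<otimes>\<^bsub>?G\<^esub> B \<in> carrier ?G" if "A \<in> carrier ?G" "B \<in> carrier ?G" for A B
    using that by (auto simp: car path_class_mult loops_at_join)
  show "\<one>\<^bsub>?G\<^esub> \<otimes>\<^bsub>?G\<^esub> A = A" if A: "A \<in> carrier ?G" for A
  proof -
    obtain p where p: "p \<in> loops_at x" "A = path_class p"
      using A by (auto simp: car)
    have "homotopic_paths UNIV ((\<lambda>_. x) +++ p) p"
      using homotopic_paths_const_left[of p] p by (auto simp: loops_at_def)
    then show ?thesis
      using p by (simp add: one path_class_mult loops_at_const path_class_eq_iff path loops_at_join)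
  qed
  show "\<exists>B\<in>carrier ?G. B \<otimes>\<^bsub>?G\<^esub> A = \<one>\<^bsub>?G\<^esub>" if A: "A \<in> carrier ?G" for A
  proof -
    obtain p where p: "p \<in> loops_at x" "A = path_class p"
      using A by (auto simp: car)
    have "homotopic_paths UNIV (reversepath p +++ p) (\<lambda>_. x)"
      using homotopic_paths_reverse_left[of p] p by (auto simp: loops_at_def)
    then have "path_class (reversepath p) \<otimes>\<^bsub>?G\<^esub> A = \<one>\<^bsub>?G\<^esub>"
      using p by (simp add: one path_class_mult loops_at_reverse path_class_eq_iff path
          loops_at_join loops_at_const)
    then show ?thesis
      using p by (auto simp: car loops_at_reverse)
  qed
  show "A \<otimes>\<^bsub>?G\<^esub> B \<otimes>\<^bsub>?G\<^esub> C = A \<otimes>\<^bsub>?G\<^esub> (B \<otimes>\<^bsub>?G\<^esub> C)"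
    if ABC: "A \<in> carrier ?G" "B \<in> carrier ?G" "C \<in> carrier ?G" for A B C
  proof -
    obtain p q r where p: "p \<in> loops_at x" "A = path_class p"
      and q: "q \<in> loops_at x" "B = path_class q" and r: "r \<in> loops_at x" "C = path_class r"
      using ABC by (auto simp: car)
    have "homotopic_paths UNIV ((p +++ q) +++ r) (p +++ (q +++ r))"
      by (rule homotopic_paths_sym, rule homotopic_paths_assoc) (use p q r in \<open>auto simp: loops_at_def\<close>)
    then show ?thesis
      using p q r
      by (simp add: path_class_mult loops_at_join path_class_eq_iff path)
  qed
qed

section \<open>The quotient and whisker topologies\<close>

text \<open>The compact-open topology, given by its standard subbasis.\<close>

definition loop_space :: "'a::topological_space \<Rightarrow> (real \<Rightarrow> 'a) topology" where
  "loop_space x = topology_generated_by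
     {{p \<in> loops_at x. p ` K \<subseteq> U} | K U. compact K \<and> K \<subseteq> {0..1} \<and> open U}"

lemma topspace_loop_space: "topspace (loop_space x) = loops_at x"
proof -
  have "{p \<in> loops_at x. p ` {} \<subseteq> UNIV} \<in>
      {{p \<in> loops_at x. p ` K \<subseteq> U} | K U. compact K \<and> K \<subseteq> {0..1::real} \<and> open U}"
    by blast
  then show ?thesis
    unfolding loop_space_def topology_generated_by_topspace by auto
qed

definition quotient_topology :: "'a topology \<Rightarrow> ('a \<Rightarrow> 'b) \<Rightarrow> 'b topology" where
  "quotient_topology X f =
     topology (\<lambda>V. V \<subseteq> f ` topspace X \<and> openin X {x \<in> topspace X. f x \<in> V})"

lemma openin_quotient_topology:
  "openin (quotient_topology X f) V \<longleftrightarrow>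
     V \<subseteq> f ` topspace X \<and> openin X {x \<in> topspace X. f x \<in> V}"
proof -
  have "istopology (\<lambda>V. V \<subseteq> f ` topspace X \<and> openin X {x \<in> topspace X. f x \<in> V})"
    unfolding istopology_def
  proof (intro conjI allI impI; (elim conjE)?)
    fix S T
    assume "openin X {x \<in> topspace X. f x \<in> S}" "openin X {x \<in> topspace X. f x \<in> T}"
    then have "openin X ({x \<in> topspace X. f x \<in> S} \<inter> {x \<in> topspace X. f x \<in> T})"
      by (rule openin_Int)
    then show "openin X {x \<in> topspace X. f x \<in> S \<inter> T}"
      by (rule back_subst) auto
  next
    fix \<K>
    assume "\<forall>K\<in>\<K>. K \<subseteq> f ` topspace X \<and> openin X {x \<in> topspace X. f x \<in> K}"
    then have "openin X (\<Union>K\<in>\<K>. {x \<in> topspace X. f x \<in> K})"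
      by blast
    then show "openin X {x \<in> topspace X. f x \<in> \<Union> \<K>}"
      by (rule back_subst) auto
  qed auto
  then show ?thesis
    by (simp add: quotient_topology_def topology_inverse')
qed

lemma topspace_quotient_topology: "topspace (quotient_topology X f) = f ` topspace X"
proof -
  have "{x \<in> topspace X. f x \<in> f ` topspace X} = topspace X"
    by auto
  then have "openin (quotient_topology X f) (f ` topspace X)"
    by (simp add: openin_quotient_topology)
  then show ?thesis
    by (meson openin_quotient_topology openin_subset openin_topspace subset_antisym)
qed

lemma quotient_map_quotient_topology: "quotient_map X (quotient_topology X f) f"
  unfolding quotient_map_def topspace_quotient_topology
  by (simp add: openin_quotient_topology)

definition qtop_fundamental_group ::
  "'a::topological_space \<Rightarrow> (real \<Rightarrow> 'a) set topology" where
  "qtop_fundamental_group x = quotient_topology (loop_space x) path_class"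

lemma topspace_qtop_fundamental_group:
  "topspace (qtop_fundamental_group x) = carrier (fundamental_group x)"
  by (simp add: qtop_fundamental_group_def topspace_quotient_topology topspace_loop_space
      fundamental_group_def)

definition whisker_basic ::
  "'a::topological_space \<Rightarrow> (real \<Rightarrow> 'a) \<Rightarrow> 'a set \<Rightarrow> (real \<Rightarrow> 'a) set set" where
  "whisker_basic x \<alpha> U = {path_class \<beta> | \<beta>. \<beta> \<in> loops_at x \<and>
     (\<exists>\<delta>\<in>loops_at x. path_image \<delta> \<subseteq> U \<and> homotopic_paths UNIV \<beta> (\<alpha> +++ \<delta>))}"

definition whisker_fundamental_group ::
  "'a::topological_space \<Rightarrow> (real \<Rightarrow> 'a) set topology" where
  "whisker_fundamental_group x =
     topology (arbitrary union_of
       (\<lambda>B. \<exists>\<alpha> U. \<alpha> \<in> loops_at x \<and> open U \<and> x \<in> U \<and> B = whisker_basic x \<alpha> U))"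

lemma whisker_basic_altdef:
  assumes "\<alpha> \<in> loops_at x"
  shows "whisker_basic x \<alpha> U = {path_class (\<alpha> +++ \<delta>) | \<delta>. \<delta> \<in> loops_at x \<and> path_image \<delta> \<subseteq> U}"
    (is "_ = ?R")
proof
  show "whisker_basic x \<alpha> U \<subseteq> ?R"
  proof
    fix A assume "A \<in> whisker_basic x \<alpha> U"
    then obtain \<beta> \<delta> where h: "A = path_class \<beta>" "\<beta> \<in> loops_at x" "\<delta> \<in> loops_at x"
      "path_image \<delta> \<subseteq> U" "homotopic_paths UNIV \<beta> (\<alpha> +++ \<delta>)"
      unfolding whisker_basic_def by blast
    then have "A = path_class (\<alpha> +++ \<delta>)"
      using path_class_eq_iff homotopic_paths_imp_path by metis
    with h show "A \<in> ?R" by blast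
  qed
  show "?R \<subseteq> whisker_basic x \<alpha> U"
  proof
    fix A assume "A \<in> ?R"
    then obtain \<delta> where h: "A = path_class (\<alpha> +++ \<delta>)" "\<delta> \<in> loops_at x" "path_image \<delta> \<subseteq> U"
      by blast
    moreover have "\<alpha> +++ \<delta> \<in> loops_at x"
      using assms h by (simp add: loops_at_join)
    moreover from this have "homotopic_paths UNIV (\<alpha> +++ \<delta>) (\<alpha> +++ \<delta>)"
      by (simp add: loops_at_def)
    ultimately show "A \<in> whisker_basic x \<alpha> U"
      unfolding whisker_basic_def by blast
  qed
qed

lemma whisker_basic_recentre:
  assumes \<alpha>: "\<alpha> \<in> loops_at x" and \<beta>: "\<beta> \<in> loops_at x"
    and mem: "path_class \<beta> \<in> whisker_basic x \<alpha> U" and "V \<subseteq> U"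
  shows "whisker_basic x \<beta> V \<subseteq> whisker_basic x \<alpha> U"
proof
  let ?G = "fundamental_group x"
  interpret Group.group ?G by (rule group_fundamental_group)
  obtain \<delta> where \<delta>: "path_class \<beta> = path_class (\<alpha> +++ \<delta>)" "\<delta> \<in> loops_at x" "path_image \<delta> \<subseteq> U"
    using mem \<alpha> by (auto simp: whisker_basic_altdef)
  fix A assume "A \<in> whisker_basic x \<beta> V"
  then obtain \<epsilon> where \<epsilon>: "A = path_class (\<beta> +++ \<epsilon>)" "\<epsilon> \<in> loops_at x" "path_image \<epsilon> \<subseteq> V"
    using \<beta> by (auto simp: whisker_basic_altdef)
  have car: "path_class p \<in> carrier ?G" if "p \<in> loops_at x" for p
    using that by (simp add: fundamental_group_def)
  have "A = path_class \<alpha> \<otimes>\<^bsub>?G\<^esub> path_class \<delta> \<otimes>\<^bsub>?G\<^esub> path_class \<epsilon>"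
    unfolding \<epsilon>(1) path_class_mult[OF \<alpha> \<delta>(2)] \<delta>(1)[symmetric]
    by (rule path_class_mult[symmetric]) (use \<beta> \<epsilon> in auto)
  also have "\<dots> = path_class \<alpha> \<otimes>\<^bsub>?G\<^esub> (path_class \<delta> \<otimes>\<^bsub>?G\<^esub> path_class \<epsilon>)"
    by (intro m_assoc car \<alpha> \<delta>(2) \<epsilon>(2))
  also have "\<dots> = path_class (\<alpha> +++ (\<delta> +++ \<epsilon>))"
    using \<alpha> \<delta>(2) \<epsilon>(2) by (simp add: path_class_mult loops_at_join)
  finally have "A = path_class (\<alpha> +++ (\<delta> +++ \<epsilon>))" .
  moreover have "path_image (\<delta> +++ \<epsilon>) \<subseteq> U"
    using \<delta>(3) \<epsilon>(3) \<open>V \<subseteq> U\<close> by (intro subset_path_image_join) auto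
  moreover have "\<delta> +++ \<epsilon> \<in> loops_at x"
    using \<delta>(2) \<epsilon>(2) by (simp add: loops_at_join)
  ultimately show "A \<in> whisker_basic x \<alpha> U"
    unfolding whisker_basic_altdef[OF \<alpha>] by blast
qed

lemma whisker_basic_self:
  assumes "\<alpha> \<in> loops_at x" "x \<in> U"
  shows "path_class \<alpha> \<in> whisker_basic x \<alpha> U"
proof -
  have "homotopic_paths UNIV (\<alpha> +++ (\<lambda>_. x)) \<alpha>"
    using homotopic_paths_const_right[of \<alpha>] assms by (auto simp: loops_at_def)
  then have "homotopic_paths UNIV \<alpha> (\<alpha> +++ (\<lambda>_. x))"
    by (rule homotopic_paths_sym)
  moreover have "path_image (\<lambda>_. x) \<subseteq> U"
    using assms by (auto simp: path_image_def)
  ultimately show ?thesis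
    using assms loops_at_const unfolding whisker_basic_def by blast
qed

lemma openin_whisker_fundamental_group:
  "openin (whisker_fundamental_group x) =
     arbitrary union_of
       (\<lambda>B. \<exists>\<alpha> U. \<alpha> \<in> loops_at x \<and> open U \<and> x \<in> U \<and> B = whisker_basic x \<alpha> U)"
    (is "_ = arbitrary union_of ?P")
proof -
  have *: "(arbitrary union_of ?P) (S \<inter> T)" if ST: "?P S" "?P T" for S T
  proof -
    obtain \<alpha> U \<beta> V where U: "\<alpha> \<in> loops_at x" "open U" "x \<in> U" "S = whisker_basic x \<alpha> U"
      and V: "\<beta> \<in> loops_at x" "open V" "x \<in> V" "T = whisker_basic x \<beta> V"
      using ST by blast
    have *: "\<exists>B. ?P B \<and> A \<in> B \<and> B \<subseteq> S \<inter> T" if A: "A \<in> S \<inter> T" for A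
    proof -
      obtain \<gamma> where \<gamma>: "\<gamma> \<in> loops_at x" "A = path_class \<gamma>"
        using A U unfolding whisker_basic_def by blast
      have "whisker_basic x \<gamma> (U \<inter> V) \<subseteq> S \<inter> T"
        using A U V \<gamma> whisker_basic_recentre[of _ x \<gamma> _ "U \<inter> V"] by simp
      moreover have "A \<in> whisker_basic x \<gamma> (U \<inter> V)"
        using U V \<gamma> by (auto intro: whisker_basic_self)
      moreover have "?P (whisker_basic x \<gamma> (U \<inter> V))"
        using U V \<gamma> by blast
      ultimately show ?thesis by blast
    qed
    show ?thesis
      unfolding arbitrary_union_of_alt by (intro ballI *)
  qed
  have "istopology (arbitrary union_of ?P)"
    unfolding istopology_base_eq by (intro allI impI, elim conjE, rule *)
  then show ?thesis
    by (simp add: whisker_fundamental_group_def topology_inverse')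
qed

lemma topspace_whisker_fundamental_group:
  "topspace (whisker_fundamental_group x) = carrier (fundamental_group x)"
proof
  let ?P = "\<lambda>B. \<exists>\<alpha> U. \<alpha> \<in> loops_at x \<and> open U \<and> x \<in> U \<and> B = whisker_basic x \<alpha> U"
  have sub: "whisker_basic x \<alpha> U \<subseteq> carrier (fundamental_group x)" for \<alpha> U
    by (auto simp: whisker_basic_def fundamental_group_def)
  have "(arbitrary union_of ?P) (topspace (whisker_fundamental_group x))"
    using openin_topspace[of "whisker_fundamental_group x"]
    unfolding openin_whisker_fundamental_group .
  then have *: "\<forall>A\<in>topspace (whisker_fundamental_group x).
      \<exists>B. ?P B \<and> A \<in> B \<and> B \<subseteq> topspace (whisker_fundamental_group x)"
    unfolding arbitrary_union_of_alt .
  show "topspace (whisker_fundamental_group x) \<subseteq> carrier (fundamental_group x)"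
  proof
    fix A assume "A \<in> topspace (whisker_fundamental_group x)"
    from bspec[OF * this] obtain \<alpha> U where "A \<in> whisker_basic x \<alpha> U"
      by blast
    then show "A \<in> carrier (fundamental_group x)"
      using sub by blast
  qed
  have "openin (whisker_fundamental_group x) (whisker_basic x \<alpha> UNIV)"
    if "\<alpha> \<in> loops_at x" for \<alpha>
    unfolding openin_whisker_fundamental_group
    by (rule arbitrary_union_of_inc, rule exI[of _ \<alpha>], rule exI[of _ UNIV]) (simp add: that)
  then have "path_class \<alpha> \<in> topspace (whisker_fundamental_group x)" if "\<alpha> \<in> loops_at x" for \<alpha>
    using whisker_basic_self[of \<alpha> x UNIV] openin_subset that by blast
  then show "carrier (fundamental_group x) \<subseteq> topspace (whisker_fundamental_group x)"
    by (auto simp: fundamental_group_def)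
qed

section \<open>Relative homotopical Hausdorff properties\<close>

definition homotopically_Hausdorff_rel ::
  "'a::topological_space \<Rightarrow> (real \<Rightarrow> 'a) set set \<Rightarrow> bool" where
  "homotopically_Hausdorff_rel x0 H \<longleftrightarrow>
    (\<forall>x. \<forall>\<alpha>\<in>paths_from x0. pathfinish \<alpha> = x \<longrightarrow>
      (\<forall>g \<in> carrier (fundamental_group x0) - H.
        \<exists>U. open U \<and> pathfinish \<alpha> \<in> U \<and>
          \<not> (\<exists>\<gamma>\<in>loops_at (pathfinish \<alpha>). path_image \<gamma> \<subseteq> U \<and>
                path_class (\<alpha> +++ \<gamma> +++ reversepath \<alpha>) \<in> H #>\<^bsub>fundamental_group x0\<^esub> g)))"

definition homotopically_path_Hausdorff_rel ::
  "'a::topological_space \<Rightarrow> (real \<Rightarrow> 'a) set set \<Rightarrow> bool" where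
  "homotopically_path_Hausdorff_rel x0 H \<longleftrightarrow>
    (\<forall>\<alpha>\<in>paths_from x0. \<forall>\<beta>\<in>paths_from x0.
      pathfinish \<alpha> = pathfinish \<beta> \<and> path_class (\<alpha> +++ reversepath \<beta>) \<notin> H \<longrightarrow>
      (\<exists>(n::nat) (t :: nat \<Rightarrow> real) (U :: nat \<Rightarrow> 'a set).
        t 0 = 0 \<and> t n = 1 \<and> (\<forall>i<n. t i < t (Suc i)) \<and>
        (\<forall>i\<in>{1..n}. open (U i) \<and> \<alpha> ` {t (i - 1)..t i} \<subseteq> U i) \<and>
        (\<forall>\<gamma>. path \<gamma> \<and>
             (\<forall>i\<in>{1..n}. \<gamma> ` {t (i - 1)..t i} \<subseteq> U i) \<and>
             (\<forall>i\<in>{0..n}. \<gamma> (t i) = \<alpha> (t i)) \<longrightarrow>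
             path_class (\<gamma> +++ reversepath \<beta>) \<notin> H)))"

end

theory Submission
  imports Defs
begin

text \<open>
  Each of the four conditions is equivalent to a fifth one, \<open>avoids_small_loops\<close>: no class outside
  \<open>H\<close> can be moved into \<open>H\<close> by appending arbitrarily small loops at the identity. In any space
  this is what it means for \<open>H\<close> to be closed in the whisker topology, and in any space it follows
  from closedness in the quotient topology, because \<open>\<delta> \<mapsto> \<alpha> * \<delta>\<close> is continuous at the constant loop.

  The group structure supplies the converses through the pointwise sum of paths. The sum is
  compatible with homotopy, and inserting constant paths shows that \<open>\<delta> + \<alpha>\<close> is homotopic both to
  \<open>\<delta> * \<alpha>\<close> and to \<open>\<alpha> * (\<delta> + \<alpha>(1))\<close> for a loop \<open>\<delta>\<close> at \<open>0\<close> and a path \<open>\<alpha>\<close> from \<open>0\<close>. This has three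
  consequences.

  First, the fundamental group is commutative, so cosets and the order of factors cause no trouble.

  Second, conjugating a loop \<open>\<gamma>\<close> at \<open>x\<close> by a path from \<open>0\<close> to \<open>x\<close> amounts to translating it to
  \<open>\<gamma> - x\<close>. Smallness of loops at arbitrary points is thereby reduced to smallness at the identity,
  which settles the homotopical Hausdorff property.

  Third, a path \<open>\<gamma>\<close> with the same endpoints as \<open>\<alpha>\<close> differs from \<open>\<alpha>\<close>, up to homotopy, by the loop
  \<open>\<gamma> - \<alpha>\<close>, which is small as soon as \<open>\<gamma>\<close> is uniformly close to \<open>\<alpha>\<close>. By compactness uniform
  closeness is enforced by finitely many conditions \<open>\<gamma>([t\<^sub>i\<^sub>-\<^sub>1, t\<^sub>i]) \<subseteq> W\<^sub>i\<close>
  (\<open>path_uniform_neighbourhood\<close>). Such conditions form at once a neighbourhood in the compact-open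
  topology and a partition as in the path Hausdorff property, so both of these follow.

  Finally, the path Hausdorff property gives back \<open>avoids_small_loops\<close> by splicing a small loop
  into the last subinterval of a partition.
\<close>

section \<open>Pointwise sums of paths\<close>

lemma homotopic_paths_pointwise_add:
  fixes p q :: "real \<Rightarrow> 'g::topological_monoid_add"
  assumes "homotopic_paths UNIV p p'" "homotopic_paths UNIV q q'"
  shows "homotopic_paths UNIV (\<lambda>t. p t + q t) (\<lambda>t. p' t + q' t)"
proof -
  obtain h :: "real \<times> real \<Rightarrow> 'g" where h: "continuous_on ({0..1} \<times> {0..1}) h"
    "\<forall>x\<in>{0..1}. h (0, x) = p x" "\<forall>x\<in>{0..1}. h (1, x) = p' x"
    "\<forall>t\<in>{0..1}. pathstart (h \<circ> Pair t) = pathstart p \<and> pathfinish (h \<circ> Pair t) = pathfinish p"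
    using assms(1) unfolding homotopic_paths by blast
  obtain k :: "real \<times> real \<Rightarrow> 'g" where k: "continuous_on ({0..1} \<times> {0..1}) k"
    "\<forall>x\<in>{0..1}. k (0, x) = q x" "\<forall>x\<in>{0..1}. k (1, x) = q' x"
    "\<forall>t\<in>{0..1}. pathstart (k \<circ> Pair t) = pathstart q \<and> pathfinish (k \<circ> Pair t) = pathfinish q"
    using assms(2) unfolding homotopic_paths by blast
  have ends: "h (t, 0) = p 0" "h (t, 1) = p 1" "k (t, 0) = q 0" "k (t, 1) = q 1"
    if "t \<in> {0..1}" for t
    using bspec[OF h(4) that] bspec[OF k(4) that] by (simp_all add: pathstart_def pathfinish_def)
  have "continuous_on ({0..1} \<times> {0..1}) (\<lambda>z. h z + k z)"
    using h(1) k(1) by (rule continuous_on_add)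
  then show ?thesis
    unfolding homotopic_paths using h(2,3) k(2,3) ends
    by (intro exI[of _ "\<lambda>z. h z + k z"]) (simp add: pathstart_def pathfinish_def)
qed

lemma path_const: "path (\<lambda>_. c)"
  by (simp add: path_def)

text \<open>
  The sum is unchanged up to homotopy when \<open>p\<close> is first run over \<open>[0, 1/2]\<close> and \<open>q\<close> over \<open>[1/2, 1]\<close>.
  At every time one of the two summands is then \<open>0\<close>, so the sum is literally the concatenation.
\<close>

lemma homotopic_paths_add_join:
  fixes p q :: "real \<Rightarrow> 'g::topological_monoid_add"
  assumes "path p" "path q" "pathfinish p = 0" "pathstart q = 0"
  shows "homotopic_paths UNIV (\<lambda>t. p t + q t) (p +++ q)"
proof -
  have "homotopic_paths UNIV p (p +++ (\<lambda>_. 0))"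
    using homotopic_paths_const_right[of p] assms by (simp add: homotopic_paths_sym)
  moreover have "homotopic_paths UNIV q ((\<lambda>_. 0) +++ q)"
    using homotopic_paths_const_left[of q] assms by (simp add: homotopic_paths_sym)
  moreover have "(\<lambda>t. (p +++ (\<lambda>_. 0)) t + ((\<lambda>_. 0) +++ q) t) = p +++ q"
    by (auto simp: joinpaths_def)
  ultimately show ?thesis
    using homotopic_paths_pointwise_add by metis
qed

text \<open>
  The other order of execution: \<open>q\<close> moves first, and \<open>p\<close> afterwards on top of the final value of \<open>q\<close>.
\<close>

lemma homotopic_paths_add_join_swapped:
  fixes p q :: "real \<Rightarrow> 'g::topological_monoid_add"
  assumes "path p" "path q" "pathstart p = 0"
  shows "homotopic_paths UNIV (\<lambda>t. p t + q t) (q +++ (\<lambda>t. p t + pathfinish q))"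
proof -
  have "homotopic_paths UNIV p ((\<lambda>_. 0) +++ p)"
    using homotopic_paths_const_left[of p] assms by (simp add: homotopic_paths_sym)
  moreover have "homotopic_paths UNIV q (q +++ (\<lambda>_. pathfinish q))"
    using homotopic_paths_const_right[of q] assms by (simp add: homotopic_paths_sym)
  moreover have "(\<lambda>t. ((\<lambda>_. 0) +++ p) t + (q +++ (\<lambda>_. pathfinish q)) t)
      = q +++ (\<lambda>t. p t + pathfinish q)"
    by (auto simp: joinpaths_def)
  ultimately show ?thesis
    using homotopic_paths_pointwise_add by metis
qed

section \<open>The fundamental group of a topological group\<close>

lemma path_class_eqI: "homotopic_paths UNIV p q \<Longrightarrow> path_class p = path_class q"
  using path_class_eq_iff homotopic_paths_imp_path by metis

lemma path_class_carrier: "p \<in> loops_at x \<Longrightarrow> path_class p \<in> carrier (fundamental_group x)"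
  by (simp add: fundamental_group_def)

lemma carrier_fundamental_groupE:
  assumes "g \<in> carrier (fundamental_group x)"
  obtains p where "p \<in> loops_at x" "g = path_class p"
  using assms by (auto simp: fundamental_group_def)

lemma path_class_reversepath:
  assumes "p \<in> loops_at x"
  shows "path_class (reversepath p) = inv\<^bsub>fundamental_group x\<^esub> path_class p"
proof -
  interpret Group.group "fundamental_group x" by (rule group_fundamental_group)
  have "path_class (reversepath p +++ p) = \<one>\<^bsub>fundamental_group x\<^esub>"
    using path_class_eqI[OF homotopic_paths_reverse_left[of p]] assms
    by (simp add: loops_at_def fundamental_group_def)
  then show ?thesis
    using assms by (intro inv_equality[symmetric])
      (simp_all add: path_class_mult loops_at_reverse path_class_carrier)
qed

lemma path_class_pointwise_add:
  fixes p q :: "real \<Rightarrow> 'g::topological_monoid_add"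
  assumes "p \<in> loops_at 0" "q \<in> loops_at 0"
  shows "path_class (\<lambda>t. p t + q t) = path_class p \<otimes>\<^bsub>fundamental_group 0\<^esub> path_class q"
  using path_class_eqI[OF homotopic_paths_add_join[of p q]] assms
  by (simp add: path_class_mult loops_at_def)

text \<open>
  The Eckmann-Hilton argument: the pointwise sum of two loops is homotopic to their concatenation in
  either order.
\<close>

lemma comm_group_fundamental_group:
  "comm_group (fundamental_group (0::'g::topological_monoid_add))"
proof -
  let ?G = "fundamental_group (0::'g)"
  have "x \<otimes>\<^bsub>?G\<^esub> y = y \<otimes>\<^bsub>?G\<^esub> x" if "x \<in> carrier ?G" "y \<in> carrier ?G" for x y
  proof -
    obtain p q where p: "p \<in> loops_at 0" "x = path_class p" and q: "q \<in> loops_at 0" "y = path_class q"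
      using \<open>x \<in> carrier ?G\<close> \<open>y \<in> carrier ?G\<close> by (meson carrier_fundamental_groupE)
    have "path_class (\<lambda>t. p t + q t) = path_class (q +++ p)"
      using path_class_eqI[OF homotopic_paths_add_join_swapped[of p q]] p q by (simp add: loops_at_def)
    then show ?thesis
      using p q by (simp add: path_class_pointwise_add path_class_mult)
  qed
  then show ?thesis
    by (intro group.group_comm_groupI group_fundamental_group)
qed

text \<open>
  With \<open>\<delta> = \<gamma> - x\<close>, where \<open>x\<close> is the end of \<open>\<alpha>\<close>, both orders of execution of \<open>\<delta> + \<alpha>\<close> give
  \<open>\<alpha> * \<gamma> \<simeq> \<delta> * \<alpha>\<close>, and the path \<open>\<alpha>\<close> cancels against its reverse.
\<close>

lemma path_class_conjugate:
  fixes \<alpha> \<gamma> :: "real \<Rightarrow> 'g::topological_group_add"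
  assumes "\<alpha> \<in> paths_from 0" "\<gamma> \<in> loops_at (pathfinish \<alpha>)"
  shows "path_class (\<alpha> +++ \<gamma> +++ reversepath \<alpha>) = path_class (\<lambda>t. \<gamma> t - pathfinish \<alpha>)"
proof -
  define \<delta> where "\<delta> = (\<lambda>t. \<gamma> t - pathfinish \<alpha>)"
  have \<alpha>: "path \<alpha>" "pathstart \<alpha> = 0"
    using assms by (auto simp: paths_from_def)
  have \<gamma>: "path \<gamma>" "pathstart \<gamma> = pathfinish \<alpha>" "pathfinish \<gamma> = pathfinish \<alpha>"
    using assms by (auto simp: loops_at_def)
  have \<delta>: "path \<delta>" "pathstart \<delta> = 0" "pathfinish \<delta> = 0"
    using \<gamma> by (auto simp: \<delta>_def path_def pathstart_def pathfinish_def intro!: continuous_on_diff)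
  note [trans] = homotopic_paths_trans
  have "homotopic_paths UNIV (\<alpha> +++ \<gamma> +++ reversepath \<alpha>) ((\<alpha> +++ \<gamma>) +++ reversepath \<alpha>)"
    using \<alpha> \<gamma> by (intro homotopic_paths_assoc) auto
  also have "homotopic_paths UNIV \<dots> ((\<delta> +++ \<alpha>) +++ reversepath \<alpha>)"
  proof (rule homotopic_paths_join)
    have "homotopic_paths UNIV (\<lambda>t. \<delta> t + \<alpha> t) (\<alpha> +++ \<gamma>)"
      using homotopic_paths_add_join_swapped[of \<delta> \<alpha>] \<alpha> \<delta> by (simp add: \<delta>_def)
    moreover have "homotopic_paths UNIV (\<lambda>t. \<delta> t + \<alpha> t) (\<delta> +++ \<alpha>)"
      using homotopic_paths_add_join[of \<delta> \<alpha>] \<alpha> \<delta> by simp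
    ultimately show "homotopic_paths UNIV (\<alpha> +++ \<gamma>) (\<delta> +++ \<alpha>)"
      by (meson homotopic_paths_sym homotopic_paths_trans)
  qed (use \<alpha> \<gamma> in auto)
  also have "homotopic_paths UNIV \<dots> (\<delta> +++ \<alpha> +++ reversepath \<alpha>)"
    using \<alpha> \<delta> by (intro homotopic_paths_sym[OF homotopic_paths_assoc]) auto
  also have "homotopic_paths UNIV \<dots> (\<delta> +++ (\<lambda>_. pathfinish \<delta>))"
    using homotopic_paths_reverse_left[of "reversepath \<alpha>"] \<alpha> \<delta>
    by (intro homotopic_paths_join) auto
  also have "homotopic_paths UNIV \<dots> \<delta>"
    using \<delta> by (intro homotopic_paths_const_right)
  finally show ?thesis
    unfolding \<delta>_def by (rule path_class_eqI)
qed

section \<open>Uniform neighbourhoods of a path\<close>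

lemma open_zero_diff_subset:
  fixes U :: "'g::topological_group_add set"
  assumes "open U" "0 \<in> U"
  obtains V where "open V" "0 \<in> V" "\<And>u v. u \<in> V \<Longrightarrow> v \<in> V \<Longrightarrow> u - v \<in> U"
proof -
  have "continuous_on UNIV (\<lambda>z::'g \<times> 'g. fst z - snd z)"
    by (intro continuous_on_diff continuous_on_fst continuous_on_snd continuous_on_id)
  then have "open ((\<lambda>z::'g \<times> 'g. fst z - snd z) -` U)"
    using assms by (simp add: open_vimage)
  moreover have "(0, 0) \<in> (\<lambda>z::'g \<times> 'g. fst z - snd z) -` U"
    using assms by simp
  ultimately obtain A B where "open A" "open B" "(0, 0) \<in> A \<times> B"
    "A \<times> B \<subseteq> (\<lambda>z::'g \<times> 'g. fst z - snd z) -` U"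
    by (rule open_prod_elim)
  then show thesis
    by (intro that[of "A \<inter> B"]) (auto simp: subset_iff)
qed

lemma open_translation:
  fixes U :: "'g::topological_group_add set"
  assumes "open U"
  shows "open {y. y - a \<in> U}"
proof -
  have "continuous_on UNIV (\<lambda>y::'g. y - a)"
    by (intro continuous_on_diff continuous_on_id continuous_on_const)
  then have "open ((\<lambda>y. y - a) -` U)"
    using assms by (simp add: open_vimage)
  then show ?thesis
    by (simp add: vimage_def)
qed

text \<open>
  Choose \<open>V\<close> with \<open>V - V \<subseteq> U\<close>. By the Lebesgue number property a fine enough uniform partition has
  the path inside a single translate \<open>W\<^sub>i = V + a\<close> on each piece, and two points of the same
  translate differ by an element of \<open>V - V\<close>. Since consecutive closed pieces cover the unit
  interval, staying in the sets \<open>W\<^sub>i\<close> bounds the difference at every time.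
\<close>

lemma path_uniform_neighbourhood:
  fixes \<alpha> :: "real \<Rightarrow> 'g::topological_group_add"
  assumes "path \<alpha>" "open U" "0 \<in> U"
  obtains n t W where "t (0::nat) = (0::real)" "t n = 1" "\<forall>i<n. t i < t (Suc i)"
    "\<forall>i\<in>{1..n}. {t (i - 1)..t i} \<subseteq> {0..1}"
    "\<forall>i\<in>{1..n}. open (W i) \<and> \<alpha> ` {t (i - 1)..t i} \<subseteq> W i"
    "\<forall>\<gamma>. (\<forall>i\<in>{1..n}. \<gamma> ` {t (i - 1)..t i} \<subseteq> W i) \<longrightarrow> (\<forall>s\<in>{0..1}. \<gamma> s - \<alpha> s \<in> U)"
proof -
  obtain V where V: "open V" "0 \<in> V" "\<And>u v. u \<in> V \<Longrightarrow> v \<in> V \<Longrightarrow> u - v \<in> U"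
    using open_zero_diff_subset[OF assms(2,3)] by metis
  define N where "N a = {y. y - a \<in> V}" for a
  have N: "open (N a)" "a \<in> N a" for a
    using V by (auto simp: N_def open_translation)
  have diff: "x - y \<in> U" if "x \<in> N a" "y \<in> N a" for x y a
  proof -
    have "x - y = (x - a) - (y - a)"
      by (simp only: diff_conv_add_uminus minus_add minus_minus add.assoc minus_add_cancel)
    then show ?thesis
      using V(3)[of "x - a" "y - a"] that by (simp add: N_def)
  qed
  \<comment> \<open>Extending the path by its end values turns the preimages into open sets of reals.\<close>
  define \<beta> where "\<beta> = (\<lambda>s. \<alpha> (max 0 (min 1 s)))"
  have \<beta>: "continuous_on UNIV \<beta>"
    unfolding \<beta>_def
    by (rule continuous_on_compose2[of "{0..1}" \<alpha>])
      (use assms(1) in \<open>auto simp: path_def intro!: continuous_intros\<close>)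
  have \<beta>eq: "\<beta> s = \<alpha> s" if "s \<in> {0..1}" for s
    using that by (simp add: \<beta>_def)
  define \<C> where "\<C> = range (\<lambda>r. \<beta> -` N (\<beta> r))"
  have cover: "{0..1} \<subseteq> \<Union>\<C>"
    using N by (auto simp: \<C>_def)
  have "open G" if "G \<in> \<C>" for G
    using that N \<beta> by (auto simp: \<C>_def intro!: open_vimage)
  then obtain e where e: "e > 0" "\<And>s. s \<in> {0..1} \<Longrightarrow> \<exists>G\<in>\<C>. ball s e \<subseteq> G"
    using Heine_Borel_lemma[OF compact_Icc cover] by metis
  obtain m where m: "inverse (real (Suc m)) < e"
    using reals_Archimedean[OF e(1)] by blast
  define n where "n = Suc m"
  define t where "t i = real i / real n" for i
  have n: "n > 0" "1 / real n < e"
    using m by (auto simp: n_def divide_inverse)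
  have t01: "t i \<in> {0..1}" if "i \<le> n" for i
    using that n by (auto simp: t_def)
  have "\<exists>r. \<beta> ` {t (i - 1)..t i} \<subseteq> N (\<beta> r)" if i: "i \<in> {1..n}" for i
  proof -
    have "t (i - 1) + 1 / real n = t i"
      using i n by (simp add: t_def field_simps of_nat_diff)
    then have "{t (i - 1)..t i} \<subseteq> ball (t i) e"
      using n by (auto simp: dist_real_def)
    then show ?thesis
      using e(2)[OF t01, of i] i unfolding \<C>_def by fastforce
  qed
  then obtain r where r: "\<And>i. i \<in> {1..n} \<Longrightarrow> \<beta> ` {t (i - 1)..t i} \<subseteq> N (\<beta> (r i))"
    by metis
  have sub: "{t (i - 1)..t i} \<subseteq> {0..1}" if "i \<in> {1..n}" for i
    using t01[of i] t01[of "i - 1"] that by force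
  have \<alpha>: "\<alpha> ` {t (i - 1)..t i} \<subseteq> N (\<beta> (r i))" if "i \<in> {1..n}" for i
  proof -
    have "\<alpha> ` {t (i - 1)..t i} = \<beta> ` {t (i - 1)..t i}"
      using sub[OF that] \<beta>eq by (intro image_cong) (auto simp: subset_iff)
    then show ?thesis
      using r[OF that] by simp
  qed
  show thesis
  proof (rule that[of t n "\<lambda>i. N (\<beta> (r i))"])
    show "t 0 = 0" "t n = 1" "\<forall>i<n. t i < t (Suc i)"
      using n by (auto simp: t_def divide_strict_right_mono)
    show "\<forall>i\<in>{1..n}. {t (i - 1)..t i} \<subseteq> {0..1}"
      using sub by blast
    show "\<forall>i\<in>{1..n}. open (N (\<beta> (r i))) \<and> \<alpha> ` {t (i - 1)..t i} \<subseteq> N (\<beta> (r i))"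
      using N \<alpha> by blast
    show "\<forall>\<gamma>. (\<forall>i\<in>{1..n}. \<gamma> ` {t (i - 1)..t i} \<subseteq> N (\<beta> (r i))) \<longrightarrow>
        (\<forall>s\<in>{0..1}. \<gamma> s - \<alpha> s \<in> U)"
    proof (intro allI impI ballI)
      fix \<gamma> and s :: real
      assume \<gamma>: "\<forall>i\<in>{1..n}. \<gamma> ` {t (i - 1)..t i} \<subseteq> N (\<beta> (r i))" and s: "s \<in> {0..1}"
      have "\<exists>i\<in>{1..n}. s \<in> {t (i - 1)..t i}"
      proof (cases "s = 0")
        case True
        then show ?thesis
          using n by (intro bexI[of _ 1]) (auto simp: t_def)
      next
        case False
        define i where "i = nat \<lceil>s * real n\<rceil>"
        have pos: "0 < s * real n" "s * real n \<le> real n"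
          using False s n by (auto simp: mult_left_le_one_le)
        then have "real i - 1 < s * real n" "s * real n \<le> real i" "i \<ge> 1"
          unfolding i_def by linarith+
        moreover have "i \<le> n"
          using pos unfolding i_def by linarith
        ultimately show ?thesis
          using n by (intro bexI[of _ i]) (auto simp: t_def field_simps of_nat_diff)
      qed
      then obtain i where i: "i \<in> {1..n}" "s \<in> {t (i - 1)..t i}"
        by blast
      show "\<gamma> s - \<alpha> s \<in> U"
        by (rule diff[of _ "\<beta> (r i)"]) (use \<gamma> \<alpha>[OF i(1)] i in blast)+
    qed
  qed
qed

section \<open>Avoiding small loops\<close>

text \<open>
  Closedness in the whisker topology, unfolded to a statement about loops so that it can be compared
  with conditions that mention no topology on the fundamental group.
\<close>

definition avoids_small_loops :: "'a::topological_space \<Rightarrow> (real \<Rightarrow> 'a) set set \<Rightarrow> bool" where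
  "avoids_small_loops x H \<longleftrightarrow>
    (\<forall>\<alpha>\<in>loops_at x. path_class \<alpha> \<notin> H \<longrightarrow>
      (\<exists>U. open U \<and> x \<in> U \<and>
        (\<forall>\<delta>\<in>loops_at x. path_image \<delta> \<subseteq> U \<longrightarrow> path_class (\<alpha> +++ \<delta>) \<notin> H)))"

text \<open>
  The complement of \<open>H\<close> is open exactly when each of its points has a basic neighbourhood inside
  it, and such a neighbourhood may be recentred at the point itself.
\<close>

lemma closedin_whisker_iff_avoids_small_loops:
  assumes "H \<subseteq> carrier (fundamental_group x)"
  shows "closedin (whisker_fundamental_group x) H \<longleftrightarrow> avoids_small_loops x H"
proof -
  let ?C = "carrier (fundamental_group x) - H"
  have basic: "whisker_basic x \<alpha> U \<subseteq> ?C \<longleftrightarrow>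
      (\<forall>\<delta>\<in>loops_at x. path_image \<delta> \<subseteq> U \<longrightarrow> path_class (\<alpha> +++ \<delta>) \<notin> H)"
    if "\<alpha> \<in> loops_at x" for \<alpha> U
    using that
    by (fastforce simp: whisker_basic_altdef path_class_carrier loops_at_join)
  have "closedin (whisker_fundamental_group x) H \<longleftrightarrow>
      (\<forall>A\<in>?C. \<exists>B. (\<exists>\<alpha> U. \<alpha> \<in> loops_at x \<and> open U \<and> x \<in> U \<and> B = whisker_basic x \<alpha> U)
         \<and> A \<in> B \<and> B \<subseteq> ?C)"
  proof -
    have "closedin (whisker_fundamental_group x) H \<longleftrightarrow> openin (whisker_fundamental_group x) ?C"
      using assms by (simp add: closedin_def topspace_whisker_fundamental_group)
    then show ?thesis
      unfolding openin_whisker_fundamental_group arbitrary_union_of_alt .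
  qed
  also have "\<dots> \<longleftrightarrow> avoids_small_loops x H"
  proof
    assume L: "\<forall>A\<in>?C. \<exists>B. (\<exists>\<alpha> U. \<alpha> \<in> loops_at x \<and> open U \<and> x \<in> U \<and> B = whisker_basic x \<alpha> U)
         \<and> A \<in> B \<and> B \<subseteq> ?C"
    show "avoids_small_loops x H"
      unfolding avoids_small_loops_def
    proof (intro ballI impI)
      fix \<alpha> assume \<alpha>: "\<alpha> \<in> loops_at x" "path_class \<alpha> \<notin> H"
      then have "path_class \<alpha> \<in> ?C"
        by (simp add: path_class_carrier)
      from bspec[OF L this] obtain \<alpha>' U where U: "\<alpha>' \<in> loops_at x" "open U" "x \<in> U"
        "path_class \<alpha> \<in> whisker_basic x \<alpha>' U" "whisker_basic x \<alpha>' U \<subseteq> ?C"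
        by blast
      have "whisker_basic x \<alpha> U \<subseteq> ?C"
        using whisker_basic_recentre[OF U(1) \<alpha>(1) U(4) order_refl] U(5) by (rule subset_trans)
      then have "\<forall>\<delta>\<in>loops_at x. path_image \<delta> \<subseteq> U \<longrightarrow> path_class (\<alpha> +++ \<delta>) \<notin> H"
        by (rule iffD1[OF basic[OF \<alpha>(1)]])
      with U(2,3) show "\<exists>U. open U \<and> x \<in> U \<and>
          (\<forall>\<delta>\<in>loops_at x. path_image \<delta> \<subseteq> U \<longrightarrow> path_class (\<alpha> +++ \<delta>) \<notin> H)"
        by blast
    qed
  next
    assume K: "avoids_small_loops x H"
    show "\<forall>A\<in>?C. \<exists>B. (\<exists>\<alpha> U. \<alpha> \<in> loops_at x \<and> open U \<and> x \<in> U \<and> B = whisker_basic x \<alpha> U)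
         \<and> A \<in> B \<and> B \<subseteq> ?C"
    proof
      fix A assume A: "A \<in> ?C"
      then obtain \<alpha> where \<alpha>: "\<alpha> \<in> loops_at x" "A = path_class \<alpha>"
        by (auto simp: fundamental_group_def)
      then obtain U where U: "open U" "x \<in> U"
        and avoid: "\<forall>\<delta>\<in>loops_at x. path_image \<delta> \<subseteq> U \<longrightarrow> path_class (\<alpha> +++ \<delta>) \<notin> H"
        using K A unfolding avoids_small_loops_def by blast
      have "whisker_basic x \<alpha> U \<subseteq> ?C"
        using avoid by (rule iffD2[OF basic[OF \<alpha>(1)]])
      moreover have "A \<in> whisker_basic x \<alpha> U"
        using whisker_basic_self[OF \<alpha>(1) U(2)] \<alpha>(2) by simp
      ultimately show "\<exists>B. (\<exists>\<alpha> U. \<alpha> \<in> loops_at x \<and> open U \<and> x \<in> U \<and> B = whisker_basic x \<alpha> U)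
         \<and> A \<in> B \<and> B \<subseteq> ?C"
        using \<alpha>(1) U by blast
    qed
  qed
  finally show ?thesis .
qed

section \<open>The quotient topology\<close>

text \<open>
  Continuity of \<open>\<delta> \<mapsto> \<alpha> * \<delta>\<close> at the constant loop, in the form that makes the quotient topology
  coarser than the whisker topology. The induction is over the generation of open sets from the
  subbasis of the compact-open topology.
\<close>

lemma loop_space_join_small_loops:
  assumes "openin (loop_space x) W" "\<alpha> \<in> loops_at x" "\<alpha> +++ (\<lambda>_. x) \<in> W"
  shows "\<exists>U. open U \<and> x \<in> U \<and> (\<forall>\<delta>\<in>loops_at x. path_image \<delta> \<subseteq> U \<longrightarrow> \<alpha> +++ \<delta> \<in> W)"
  using openin_topology_generated_by[OF assms(1)[unfolded loop_space_def]] assms(3)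
proof induction
  case Empty
  then show ?case by simp
next
  case (Int a b)
  then obtain U V where "open U" "x \<in> U" "\<forall>\<delta>\<in>loops_at x. path_image \<delta> \<subseteq> U \<longrightarrow> \<alpha> +++ \<delta> \<in> a"
    "open V" "x \<in> V" "\<forall>\<delta>\<in>loops_at x. path_image \<delta> \<subseteq> V \<longrightarrow> \<alpha> +++ \<delta> \<in> b"
    by blast
  then show ?case
    by (intro exI[of _ "U \<inter> V"]) auto
next
  case (UN K)
  then show ?case by (meson Union_iff)
next
  case (Basis s)
  then obtain K U where KU: "s = {p \<in> loops_at x. p ` K \<subseteq> U}" "K \<subseteq> {0..1}" "open U"
    by blast
  then have *: "(\<alpha> +++ (\<lambda>_. x)) k \<in> U" if "k \<in> K" for k
    using Basis that by blast
  \<comment> \<open>The second half of the loop is constrained only if \<open>K\<close> meets it, and then \<open>U\<close> contains \<open>x\<close>.\<close>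
  define N where "N = (if x \<in> U then U else UNIV)"
  have "\<alpha> +++ \<delta> \<in> s" if \<delta>: "\<delta> \<in> loops_at x" "path_image \<delta> \<subseteq> N" for \<delta>
  proof -
    have "(\<alpha> +++ \<delta>) k \<in> U" if k: "k \<in> K" for k
    proof (cases "k \<le> 1/2")
      case True
      then show ?thesis
        using *[OF k] by (simp add: joinpaths_def)
    next
      case False
      then have "x \<in> U"
        using *[OF k] by (simp add: joinpaths_def)
      moreover have "2 * k - 1 \<in> {0..1}"
        using KU(2) k False by auto
      ultimately show ?thesis
        using \<delta>(2) False by (auto simp: N_def joinpaths_def path_image_def)
    qed
    then show ?thesis
      using \<delta> assms(2) KU by (auto intro: loops_at_join)
  qed
  moreover have "open N" "x \<in> N"
    using KU by (auto simp: N_def)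
  ultimately show ?case by blast
qed

lemma closedin_qtop_imp_avoids_small_loops:
  assumes "closedin (qtop_fundamental_group x) H"
  shows "avoids_small_loops x H"
  unfolding avoids_small_loops_def
proof (intro ballI impI)
  fix \<alpha> assume \<alpha>: "\<alpha> \<in> loops_at x" "path_class \<alpha> \<notin> H"
  let ?W = "{p \<in> loops_at x. path_class p \<in> carrier (fundamental_group x) - H}"
  have W: "openin (loop_space x) ?W"
    using assms
    by (simp add: closedin_def topspace_qtop_fundamental_group)
      (simp add: qtop_fundamental_group_def openin_quotient_topology topspace_loop_space)
  have "path_class (\<alpha> +++ (\<lambda>_. x)) = path_class \<alpha>"
    using path_class_eqI[OF homotopic_paths_const_right[of \<alpha>]] \<alpha> by (simp add: loops_at_def)
  then have "\<alpha> +++ (\<lambda>_. x) \<in> ?W"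
    using \<alpha> by (simp add: path_class_carrier loops_at_join loops_at_const)
  then show "\<exists>U. open U \<and> x \<in> U \<and>
      (\<forall>\<delta>\<in>loops_at x. path_image \<delta> \<subseteq> U \<longrightarrow> path_class (\<alpha> +++ \<delta>) \<notin> H)"
    using loop_space_join_small_loops[OF W \<alpha>(1)] by blast
qed

text \<open>
  A loop uniformly close to \<open>\<alpha>\<close> is the pointwise sum of \<open>\<alpha>\<close> and the small loop \<open>\<beta> - \<alpha>\<close>.
\<close>

lemma avoids_small_loops_nearby:
  fixes \<alpha> :: "real \<Rightarrow> 'g::topological_group_add"
  assumes "\<alpha> \<in> loops_at 0" "\<beta> \<in> loops_at 0"
    and "\<forall>\<delta>\<in>loops_at 0. path_image \<delta> \<subseteq> U \<longrightarrow> path_class (\<alpha> +++ \<delta>) \<notin> H"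
    and "\<forall>s\<in>{0..1}. \<beta> s - \<alpha> s \<in> U"
  shows "path_class \<beta> \<notin> H"
proof -
  interpret comm_group "fundamental_group (0::'g)" by (rule comm_group_fundamental_group)
  define \<delta> where "\<delta> = (\<lambda>s. \<beta> s - \<alpha> s)"
  have \<delta>: "\<delta> \<in> loops_at 0" "path_image \<delta> \<subseteq> U"
    using assms by (auto simp: \<delta>_def loops_at_def path_def pathstart_def pathfinish_def
        path_image_def intro!: continuous_on_diff)
  have "path_class \<beta> = path_class (\<lambda>s. \<delta> s + \<alpha> s)"
    by (simp add: \<delta>_def)
  also have "\<dots> = path_class \<delta> \<otimes>\<^bsub>fundamental_group 0\<^esub> path_class \<alpha>"
    by (rule path_class_pointwise_add[OF \<delta>(1) assms(1)])
  also have "\<dots> = path_class (\<alpha> +++ \<delta>)"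
    using m_comm[of "path_class \<delta>" "path_class \<alpha>"] \<delta>(1) assms(1)
    by (simp add: path_class_carrier path_class_mult)
  finally show ?thesis
    using assms(3) \<delta> by simp
qed

text \<open>
  The conditions that force a loop to be uniformly close to \<open>\<alpha>\<close> are finitely many subbasic
  conditions of the compact-open topology.
\<close>

lemma avoids_small_loops_imp_closedin_qtop:
  fixes H :: "(real \<Rightarrow> 'g::topological_group_add) set set"
  assumes "H \<subseteq> carrier (fundamental_group 0)" and K: "avoids_small_loops 0 H"
  shows "closedin (qtop_fundamental_group 0) H"
proof -
  let ?W = "{p \<in> loops_at 0. path_class p \<in> carrier (fundamental_group 0) - H}"
  have "openin (loop_space (0::'g)) ?W"
  proof (subst openin_subopen, intro ballI)
    fix \<alpha> assume "\<alpha> \<in> ?W"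
    then have \<alpha>: "\<alpha> \<in> loops_at 0" "path_class \<alpha> \<notin> H" by auto
    then obtain U where U: "open U" "0 \<in> U"
      "\<forall>\<delta>\<in>loops_at 0. path_image \<delta> \<subseteq> U \<longrightarrow> path_class (\<alpha> +++ \<delta>) \<notin> H"
      using K unfolding avoids_small_loops_def by blast
    have "path \<alpha>" using \<alpha> by (simp add: loops_at_def)
    then obtain n t W where W: "t (0::nat) = (0::real)" "t n = 1" "\<forall>i<n. t i < t (Suc i)"
      "\<forall>i\<in>{1..n}. {t (i - 1)..t i} \<subseteq> {0..1}"
      "\<forall>i\<in>{1..n}. open (W i) \<and> \<alpha> ` {t (i - 1)..t i} \<subseteq> W i"
      and near: "\<forall>\<gamma>. (\<forall>i\<in>{1..n}. \<gamma> ` {t (i - 1)..t i} \<subseteq> W i) \<longrightarrow> (\<forall>s\<in>{0..1}. \<gamma> s - \<alpha> s \<in> U)"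
      by (rule path_uniform_neighbourhood[OF _ U(1,2)]) (rule that)
    define B where "B i = {p \<in> loops_at (0::'g). p ` {t (i - 1)..t i} \<subseteq> W i}" for i
    have "openin (loop_space 0) (B i)" if "i \<in> {1..n}" for i
      unfolding loop_space_def
    proof (rule topology_generated_by_Basis)
      have "compact {t (i - 1)..t i}"
        by (rule compact_Icc)
      then show "B i \<in> {{p \<in> loops_at 0. p ` K \<subseteq> U} |K U. compact K \<and> K \<subseteq> {0..1} \<and> open U}"
        unfolding B_def using W(4,5) that by blast
    qed
    then have "openin (loop_space 0) ((\<Inter>i\<in>{1..n}. B i) \<inter> topspace (loop_space 0))"
      by (intro openin_INT) auto
    moreover have "\<alpha> \<in> (\<Inter>i\<in>{1..n}. B i) \<inter> topspace (loop_space 0)"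
      using \<alpha> W(5) by (auto simp: B_def topspace_loop_space)
    moreover have "\<beta> \<in> ?W" if \<beta>: "\<beta> \<in> (\<Inter>i\<in>{1..n}. B i) \<inter> topspace (loop_space 0)" for \<beta>
    proof -
      have "\<beta> \<in> loops_at 0"
        using \<beta> by (simp add: topspace_loop_space)
      moreover have "\<forall>i\<in>{1..n}. \<beta> ` {t (i - 1)..t i} \<subseteq> W i"
        using \<beta> unfolding B_def by blast
      then have "\<forall>s\<in>{0..1}. \<beta> s - \<alpha> s \<in> U"
        using near by blast
      ultimately have "path_class \<beta> \<notin> H" "\<beta> \<in> loops_at 0"
        using avoids_small_loops_nearby[OF \<alpha>(1) _ U(3)] by blast+
      then show ?thesis
        by (simp add: path_class_carrier)
    qed
    ultimately show "\<exists>T. openin (loop_space 0) T \<and> \<alpha> \<in> T \<and> T \<subseteq> ?W"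
      by blast
  qed
  then show ?thesis
    using assms(1)
    by (simp add: closedin_def topspace_qtop_fundamental_group)
      (auto simp: qtop_fundamental_group_def openin_quotient_topology topspace_loop_space
        fundamental_group_def)
qed

section \<open>The relative Hausdorff properties\<close>

text \<open>
  Translation to the identity turns the conjugated loop in the Hausdorff property into a loop at
  \<open>0\<close>; the constant path shows conversely that the condition at \<open>0\<close> is an instance of the property.
\<close>

lemma homotopically_Hausdorff_rel_iff_avoids_small_loops:
  fixes H :: "(real \<Rightarrow> 'g::topological_group_add) set set"
  assumes "subgroup H (fundamental_group 0)"
  shows "homotopically_Hausdorff_rel 0 H \<longleftrightarrow> avoids_small_loops 0 H"
proof -
  let ?G = "fundamental_group (0::'g)"
  interpret comm_group ?G by (rule comm_group_fundamental_group)
  interpret H: subgroup H ?G by (rule assms)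
  \<comment> \<open>By commutativity the coset condition says that a small loop moves the inverse of \<open>g\<close> into \<open>H\<close>.\<close>
  have coset: "d \<in> H #>\<^bsub>?G\<^esub> g \<longleftrightarrow> inv\<^bsub>?G\<^esub> g \<otimes>\<^bsub>?G\<^esub> d \<in> H"
    if "d \<in> carrier ?G" "g \<in> carrier ?G" for d g
  proof -
    have "d \<in> H #>\<^bsub>?G\<^esub> g \<longleftrightarrow> d \<otimes>\<^bsub>?G\<^esub> inv\<^bsub>?G\<^esub> g \<in> H"
    proof
      assume "d \<in> H #>\<^bsub>?G\<^esub> g"
      then obtain h where "h \<in> H" "d = h \<otimes>\<^bsub>?G\<^esub> g"
        by (auto simp: r_coset_def)
      then show "d \<otimes>\<^bsub>?G\<^esub> inv\<^bsub>?G\<^esub> g \<in> H"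
        using that by (simp add: m_assoc)
    next
      assume "d \<otimes>\<^bsub>?G\<^esub> inv\<^bsub>?G\<^esub> g \<in> H"
      moreover have "d = d \<otimes>\<^bsub>?G\<^esub> inv\<^bsub>?G\<^esub> g \<otimes>\<^bsub>?G\<^esub> g"
        using that by (simp add: m_assoc)
      ultimately show "d \<in> H #>\<^bsub>?G\<^esub> g"
        unfolding r_coset_def by blast
    qed
    then show ?thesis
      using that by (simp add: m_comm)
  qed
  show ?thesis
  proof
    assume hH: "homotopically_Hausdorff_rel 0 H"
    show "avoids_small_loops 0 H"
      unfolding avoids_small_loops_def
    proof (intro ballI impI)
      fix \<alpha> :: "real \<Rightarrow> 'g" assume \<alpha>: "\<alpha> \<in> loops_at 0" "path_class \<alpha> \<notin> H"
      let ?g = "inv\<^bsub>?G\<^esub> path_class \<alpha>" and ?c = "\<lambda>_::real. 0::'g"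
      have g: "?g \<in> carrier ?G - H"
        using \<alpha> H.m_inv_closed[of ?g] by (auto simp: path_class_carrier)
      have c: "?c \<in> paths_from 0" "pathfinish ?c = 0"
        by (simp_all add: paths_from_def path_const pathstart_def pathfinish_def)
      obtain U where U: "open U" "0 \<in> U"
        "\<not> (\<exists>\<gamma>\<in>loops_at 0. path_image \<gamma> \<subseteq> U \<and>
            path_class (?c +++ \<gamma> +++ reversepath ?c) \<in> H #>\<^bsub>?G\<^esub> ?g)"
        using hH c g unfolding homotopically_Hausdorff_rel_def by metis
      have "path_class (\<alpha> +++ \<delta>) \<notin> H" if \<delta>: "\<delta> \<in> loops_at 0" "path_image \<delta> \<subseteq> U" for \<delta>
      proof -
        have "path_class (?c +++ \<delta> +++ reversepath ?c) = path_class \<delta>"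
          using path_class_conjugate[OF c(1), of \<delta>] \<delta> c by simp
        then have "path_class \<delta> \<notin> H #>\<^bsub>?G\<^esub> ?g"
          using U(3) \<delta> by metis
        then show ?thesis
          using coset[of "path_class \<delta>" ?g] \<alpha> \<delta>
          by (simp add: path_class_carrier path_class_mult)
      qed
      then show "\<exists>U. open U \<and> 0 \<in> U \<and>
          (\<forall>\<delta>\<in>loops_at 0. path_image \<delta> \<subseteq> U \<longrightarrow> path_class (\<alpha> +++ \<delta>) \<notin> H)"
        using U by blast
    qed
  next
    assume K: "avoids_small_loops 0 H"
    show "homotopically_Hausdorff_rel 0 H"
      unfolding homotopically_Hausdorff_rel_def
    proof (intro allI ballI impI)
      fix x :: 'g and \<alpha> g
      assume \<alpha>: "\<alpha> \<in> paths_from 0" "pathfinish \<alpha> = x" and g: "g \<in> carrier ?G - H"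
      obtain p where p: "p \<in> loops_at 0" "g = path_class p"
        using g carrier_fundamental_groupE by blast
      have "path_class (reversepath p) \<notin> H"
        using g p H.m_inv_closed[of "path_class (reversepath p)"]
        by (auto simp: path_class_reversepath)
      then obtain U where U: "open U" "0 \<in> U"
        "\<forall>\<delta>\<in>loops_at 0. path_image \<delta> \<subseteq> U \<longrightarrow> path_class (reversepath p +++ \<delta>) \<notin> H"
        using K loops_at_reverse[OF p(1)] unfolding avoids_small_loops_def by blast
      have "path_class (\<alpha> +++ \<gamma> +++ reversepath \<alpha>) \<notin> H #>\<^bsub>?G\<^esub> g"
        if \<gamma>: "\<gamma> \<in> loops_at x" "path_image \<gamma> \<subseteq> {y. y - x \<in> U}" for \<gamma>
      proof -
        define \<delta> where "\<delta> = (\<lambda>t. \<gamma> t - x)"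
        have \<delta>: "\<delta> \<in> loops_at 0" "path_image \<delta> \<subseteq> U"
          using \<gamma> by (auto simp: \<delta>_def loops_at_def path_def pathstart_def pathfinish_def
              path_image_def intro!: continuous_on_diff)
        have "path_class (\<alpha> +++ \<gamma> +++ reversepath \<alpha>) = path_class \<delta>"
          using path_class_conjugate[OF \<alpha>(1)] \<alpha>(2) \<gamma>(1) by (simp add: \<delta>_def)
        moreover have "inv\<^bsub>?G\<^esub> g \<otimes>\<^bsub>?G\<^esub> path_class \<delta> \<notin> H"
          using U(3) \<delta> p
          by (simp add: path_class_reversepath[symmetric] path_class_mult loops_at_reverse)
        ultimately show ?thesis
          using coset g \<delta>(1) by (simp add: path_class_carrier)
      qed
      moreover have "open {y. y - x \<in> U}" "x \<in> {y. y - x \<in> U}"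
        using U by (auto simp: open_translation)
      ultimately show "\<exists>U. open U \<and> pathfinish \<alpha> \<in> U \<and>
          \<not> (\<exists>\<gamma>\<in>loops_at (pathfinish \<alpha>). path_image \<gamma> \<subseteq> U \<and>
              path_class (\<alpha> +++ \<gamma> +++ reversepath \<alpha>) \<in> H #>\<^bsub>?G\<^esub> g)"
        unfolding \<alpha>(2) by blast
    qed
  qed
qed

text \<open>
  A path \<open>\<gamma>\<close> in the tube around \<open>\<alpha>\<close> with the same endpoints is \<open>\<delta> + \<alpha>\<close> for a small loop \<open>\<delta>\<close>, so
  \<open>\<gamma>\<close> followed by the reverse of \<open>\<beta>\<close> is \<open>\<alpha>\<close> followed by the reverse of \<open>\<beta>\<close>, translated by \<open>\<delta>\<close>.
\<close>

lemma avoids_small_loops_imp_homotopically_path_Hausdorff_rel: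
  fixes H :: "(real \<Rightarrow> 'g::topological_group_add) set set"
  assumes "avoids_small_loops 0 H"
  shows "homotopically_path_Hausdorff_rel 0 H"
  unfolding homotopically_path_Hausdorff_rel_def
proof (intro ballI impI, elim conjE)
  fix \<alpha> \<beta> :: "real \<Rightarrow> 'g"
  assume \<alpha>\<beta>: "\<alpha> \<in> paths_from 0" "\<beta> \<in> paths_from 0" "pathfinish \<alpha> = pathfinish \<beta>"
    and notin: "path_class (\<alpha> +++ reversepath \<beta>) \<notin> H"
  interpret comm_group "fundamental_group (0::'g)" by (rule comm_group_fundamental_group)
  have loop: "\<alpha> +++ reversepath \<beta> \<in> loops_at 0"
    using \<alpha>\<beta> by (auto simp: paths_from_def loops_at_def)
  then obtain U where U: "open U" "0 \<in> U"
    "\<forall>\<delta>\<in>loops_at 0. path_image \<delta> \<subseteq> U \<longrightarrow> path_class ((\<alpha> +++ reversepath \<beta>) +++ \<delta>) \<notin> H"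
    using assms notin unfolding avoids_small_loops_def by blast
  have "path \<alpha>" using \<alpha>\<beta> by (simp add: paths_from_def)
  then obtain n t W where W: "t (0::nat) = (0::real)" "t n = 1" "\<forall>i<n. t i < t (Suc i)"
    "\<forall>i\<in>{1..n}. {t (i - 1)..t i} \<subseteq> {0..1}"
    "\<forall>i\<in>{1..n}. open (W i) \<and> \<alpha> ` {t (i - 1)..t i} \<subseteq> W i"
    and near: "\<forall>\<gamma>. (\<forall>i\<in>{1..n}. \<gamma> ` {t (i - 1)..t i} \<subseteq> W i) \<longrightarrow> (\<forall>s\<in>{0..1}. \<gamma> s - \<alpha> s \<in> U)"
    by (rule path_uniform_neighbourhood[OF _ U(1,2)]) (rule that)
  have "path_class (\<gamma> +++ reversepath \<beta>) \<notin> H"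
    if \<gamma>: "path \<gamma>" "\<forall>i\<in>{1..n}. \<gamma> ` {t (i - 1)..t i} \<subseteq> W i" "\<forall>i\<in>{0..n}. \<gamma> (t i) = \<alpha> (t i)" for \<gamma>
  proof -
    have ends: "\<gamma> 0 = \<alpha> 0" "\<gamma> 1 = \<alpha> 1"
      using bspec[OF \<gamma>(3), of 0] bspec[OF \<gamma>(3), of n] W by simp_all
    define \<delta> where "\<delta> = (\<lambda>s. \<gamma> s - \<alpha> s)"
    have \<delta>: "\<delta> \<in> loops_at 0" "path_image \<delta> \<subseteq> U"
      using mp[OF spec[OF near] \<gamma>(2)] \<gamma>(1) \<open>path \<alpha>\<close> ends
      by (auto simp: \<delta>_def loops_at_def path_def pathstart_def pathfinish_def
          path_image_def intro!: continuous_on_diff)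
    have eq: "\<gamma> = (\<lambda>s. \<delta> s + \<alpha> s)"
      by (simp add: \<delta>_def)
    have h: "homotopic_paths UNIV \<gamma> (\<delta> +++ \<alpha>)"
      unfolding eq using \<delta> \<alpha>\<beta>
      by (intro homotopic_paths_add_join) (auto simp: loops_at_def paths_from_def)
    note [trans] = homotopic_paths_trans
    have "homotopic_paths UNIV (\<gamma> +++ reversepath \<beta>) ((\<delta> +++ \<alpha>) +++ reversepath \<beta>)"
      by (rule homotopic_paths_join[OF h])
        (use \<alpha>\<beta> ends in \<open>auto simp: paths_from_def pathfinish_def\<close>)
    also have "homotopic_paths UNIV \<dots> (\<delta> +++ \<alpha> +++ reversepath \<beta>)"
      using \<alpha>\<beta> \<delta>(1) by (intro homotopic_paths_sym[OF homotopic_paths_assoc])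
        (auto simp: paths_from_def loops_at_def)
    finally
    have "path_class (\<gamma> +++ reversepath \<beta>) = path_class (\<delta> +++ \<alpha> +++ reversepath \<beta>)"
      by (rule path_class_eqI)
    also have "\<dots> = path_class ((\<alpha> +++ reversepath \<beta>) +++ \<delta>)"
      using m_comm[of "path_class \<delta>" "path_class (\<alpha> +++ reversepath \<beta>)"] \<delta>(1) loop
      by (simp add: path_class_carrier path_class_mult)
    finally show ?thesis
      using U(3) \<delta> by simp
  qed
  then show "\<exists>(n::nat) (t :: nat \<Rightarrow> real) (U :: nat \<Rightarrow> 'g set).
        t 0 = 0 \<and> t n = 1 \<and> (\<forall>i<n. t i < t (Suc i)) \<and>
        (\<forall>i\<in>{1..n}. open (U i) \<and> \<alpha> ` {t (i - 1)..t i} \<subseteq> U i) \<and>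
        (\<forall>\<gamma>. path \<gamma> \<and>
             (\<forall>i\<in>{1..n}. \<gamma> ` {t (i - 1)..t i} \<subseteq> U i) \<and>
             (\<forall>i\<in>{0..n}. \<gamma> (t i) = \<alpha> (t i)) \<longrightarrow>
             path_class (\<gamma> +++ reversepath \<beta>) \<notin> H)"
    using W by (intro exI[of _ n] exI[of _ t] exI[of _ W]) blast
qed

text \<open>
  The property is applied to \<open>\<alpha>\<^sub>0\<close> followed by a constant path. Being constant on the second half,
  this loop leaves room in the last subinterval of any partition for a small loop \<open>\<delta>\<close>, run there
  as a reparametrization \<open>\<delta>'\<close>. Adding \<open>\<delta>'\<close> pointwise disturbs neither the earlier subintervals nor
  the partition points, and up to homotopy it appends \<open>\<delta>\<close> to \<open>\<alpha>\<^sub>0\<close>.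
\<close>

lemma homotopically_path_Hausdorff_rel_imp_avoids_small_loops:
  fixes H :: "(real \<Rightarrow> 'g::topological_group_add) set set"
  assumes "homotopically_path_Hausdorff_rel 0 H"
  shows "avoids_small_loops 0 H"
  unfolding avoids_small_loops_def
proof (intro ballI impI)
  fix \<alpha>0 :: "real \<Rightarrow> 'g"
  assume \<alpha>0: "\<alpha>0 \<in> loops_at 0" "path_class \<alpha>0 \<notin> H"
  let ?c = "\<lambda>_::real. 0::'g"
  define \<alpha> where "\<alpha> = \<alpha>0 +++ ?c"
  have \<alpha>: "\<alpha> \<in> loops_at 0"
    unfolding \<alpha>_def using \<alpha>0 by (intro loops_at_join loops_at_const)
  have c: "?c \<in> paths_from 0" "pathfinish ?c = 0" "reversepath ?c = ?c"
    by (simp_all add: paths_from_def path_const pathstart_def pathfinish_def reversepath_def)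
  have class_c: "path_class (p +++ ?c) = path_class p" if "p \<in> loops_at 0" for p
    using path_class_eqI[OF homotopic_paths_const_right[of p]] that by (simp add: loops_at_def)
  have class_\<alpha>: "path_class \<alpha> = path_class \<alpha>0"
    unfolding \<alpha>_def using \<alpha>0(1) by (rule class_c)
  have from0: "\<alpha> \<in> paths_from 0" and notin: "pathfinish \<alpha> = pathfinish ?c \<and>
    path_class (\<alpha> +++ reversepath ?c) \<notin> H"
    using \<alpha> \<alpha>0 c class_c class_\<alpha> by (auto simp: paths_from_def loops_at_def)
  then obtain n t W where W: "t (0::nat) = (0::real)" "t n = 1" "\<forall>i<n. t i < t (Suc i)"
    "\<forall>i\<in>{1..n}. open (W i) \<and> \<alpha> ` {t (i - 1)..t i} \<subseteq> W i"
    and sep: "\<forall>\<gamma>. path \<gamma> \<and> (\<forall>i\<in>{1..n}. \<gamma> ` {t (i - 1)..t i} \<subseteq> W i) \<and>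
      (\<forall>i\<in>{0..n}. \<gamma> (t i) = \<alpha> (t i)) \<longrightarrow> path_class (\<gamma> +++ reversepath ?c) \<notin> H"
    using bspec[OF bspec[OF assms[unfolded homotopically_path_Hausdorff_rel_def] from0] c(1)]
    by (elim impE exE conjE) blast+
  have n: "n > 0"
    using W by (cases n) auto
  have mono: "t i \<le> t (n - 1)" if "i < n" for i
  proof -
    have "i \<le> n - 1" using that by simp
    then show ?thesis
    proof (induction rule: inc_induct)
      case (step k)
      then have "t k < t (Suc k)"
        using W(3) by auto
      then show ?case
        using step.IH by simp
    qed simp
  qed
  \<comment> \<open>After time \<open>s\<close> the loop rests at \<open>0\<close> and only the last set \<open>W n\<close> is imposed.\<close>
  define s where "s = max (t (n - 1)) (1/2)"
  have s: "t (n - 1) \<le> s" "1/2 \<le> s" "s < 1"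
    using W(2,3) n by (auto simp: s_def dest: spec[of _ "n - 1"])
  have tail: "\<alpha> \<tau> = 0" if "\<tau> \<ge> s" for \<tau>
  proof (cases "\<tau> = 1/2")
    case True
    have "\<alpha> \<tau> = \<alpha>0 1"
      unfolding True by (simp add: \<alpha>_def joinpaths_def)
    then show ?thesis
      using \<alpha>0(1) by (simp add: loops_at_def pathfinish_def)
  next
    case False
    then show ?thesis
      using that s by (simp add: \<alpha>_def joinpaths_def)
  qed
  have "\<alpha> 1 \<in> W n"
  proof -
    have "1 \<in> {t (n - 1)..t n}" using s W(2) by simp
    moreover have "n \<in> {1..n}" using n by simp
    ultimately show ?thesis using W(4) by blast
  qed
  then have Wn: "open (W n)" "0 \<in> W n"
    using W(4) n tail[of 1] s by auto
  have "path_class (\<alpha>0 +++ \<delta>) \<notin> H" if \<delta>: "\<delta> \<in> loops_at 0" "path_image \<delta> \<subseteq> W n" for \<delta>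
  proof -
    define \<phi> where "\<phi> \<tau> = max 0 ((\<tau> - s) / (1 - s))" for \<tau>
    define \<delta>' where "\<delta>' = (\<lambda>\<tau>. \<delta> (\<phi> \<tau>))"
    define \<gamma> where "\<gamma> = (\<lambda>\<tau>. \<alpha> \<tau> + \<delta>' \<tau>)"
    have \<phi>: "continuous_on {0..1} \<phi>" "\<phi> \<in> {0..1} \<rightarrow> {0..1}" "\<phi> 0 = 0" "\<phi> 1 = 1"
      using s by (auto simp: \<phi>_def field_simps intro!: continuous_intros)
    have \<delta>0: "\<delta> 0 = 0" "\<delta> 1 = 0"
      using \<delta>(1) by (auto simp: loops_at_def pathstart_def pathfinish_def)
    have "homotopic_paths UNIV \<delta> \<delta>'"
      using \<delta>(1) \<phi> by (intro homotopic_paths_reparametrize[where f = \<phi>])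
        (auto simp: \<delta>'_def loops_at_def)
    then have "path \<delta>'" and class_\<delta>': "path_class \<delta>' = path_class \<delta>"
      using homotopic_paths_imp_path path_class_eqI by blast+
    then have \<delta>': "\<delta>' \<in> loops_at 0"
      using \<delta>0 \<phi> by (simp add: loops_at_def \<delta>'_def pathstart_def pathfinish_def)
    have early: "\<gamma> \<tau> = \<alpha> \<tau>" if "\<tau> \<le> s" for \<tau>
    proof -
      have "\<phi> \<tau> = 0"
        using that s by (simp add: \<phi>_def divide_le_0_iff)
      then show ?thesis
        by (simp add: \<gamma>_def \<delta>'_def \<delta>0)
    qed
    have "path_class (\<gamma> +++ reversepath ?c) \<notin> H"
    proof (rule sep[rule_format], intro conjI)
      show "path \<gamma>"
        using \<alpha> \<delta>' by (auto simp: \<gamma>_def loops_at_def path_def intro: continuous_on_add)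
      show "\<forall>i\<in>{1..n}. \<gamma> ` {t (i - 1)..t i} \<subseteq> W i"
      proof (intro ballI image_subsetI)
        fix i \<tau> assume i: "i \<in> {1..n}" and \<tau>: "\<tau> \<in> {t (i - 1)..t i}"
        have \<alpha>W: "\<alpha> \<tau> \<in> W i"
          using W(4) i \<tau> by blast
        show "\<gamma> \<tau> \<in> W i"
        proof (cases "\<tau> \<le> s")
          case True
          then show ?thesis using early \<alpha>W by simp
        next
          case False
          then have "i = n"
            using mono[of i] i \<tau> s(1) by fastforce
          then have "\<tau> \<in> {0..1}"
            using \<tau> W(2) False s by auto
          then have "\<gamma> \<tau> \<in> path_image \<delta>"
            using \<phi>(2) tail[of \<tau>] False by (auto simp: \<gamma>_def \<delta>'_def path_image_def)
          then show ?thesis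
            using \<delta>(2) \<open>i = n\<close> by blast
        qed
      qed
      show "\<forall>i\<in>{0..n}. \<gamma> (t i) = \<alpha> (t i)"
      proof
        fix i assume "i \<in> {0..n}"
        then consider "i < n" | "i = n" by fastforce
        then show "\<gamma> (t i) = \<alpha> (t i)"
        proof cases
          case 1
          then show ?thesis using mono[of i] s(1) by (intro early) simp
        next
          case 2
          then show ?thesis using W(2) \<phi> \<delta>0 by (simp add: \<gamma>_def \<delta>'_def)
        qed
      qed
    qed
    moreover have "path_class (\<gamma> +++ reversepath ?c) = path_class (\<alpha>0 +++ \<delta>)"
    proof -
      have "\<gamma> \<in> loops_at 0"
        using \<alpha> \<delta>' by (auto simp: \<gamma>_def loops_at_def path_def pathstart_def pathfinish_def
            intro: continuous_on_add)
      then have "path_class (\<gamma> +++ reversepath ?c) = path_class \<gamma>"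
        using class_c c(3) by simp
      also have "\<dots> = path_class \<alpha> \<otimes>\<^bsub>fundamental_group 0\<^esub> path_class \<delta>'"
        unfolding \<gamma>_def by (rule path_class_pointwise_add[OF \<alpha> \<delta>'])
      also have "\<dots> = path_class (\<alpha>0 +++ \<delta>)"
        using \<alpha>0(1) \<delta>(1) by (simp add: class_\<alpha> class_\<delta>' path_class_mult)
      finally show ?thesis .
    qed
    ultimately show ?thesis by simp
  qed
  then show "\<exists>U. open U \<and> 0 \<in> U \<and>
      (\<forall>\<delta>\<in>loops_at 0. path_image \<delta> \<subseteq> U \<longrightarrow> path_class (\<alpha>0 +++ \<delta>) \<notin> H)"
    using Wn by blast
qed

theorem proposition2p9:
  fixes H :: "(real \<Rightarrow> 'g::topological_group_add) set set"
  assumes "connected (UNIV :: 'g set)"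
    and "locally path_connected (UNIV :: 'g set)"
    and "subgroup H (fundamental_group (0::'g))"
  shows "(closedin (qtop_fundamental_group (0::'g)) H
            \<longleftrightarrow> closedin (whisker_fundamental_group (0::'g)) H)
       \<and> (closedin (whisker_fundamental_group (0::'g)) H
            \<longleftrightarrow> homotopically_Hausdorff_rel (0::'g) H)
       \<and> (homotopically_Hausdorff_rel (0::'g) H
            \<longleftrightarrow> homotopically_path_Hausdorff_rel (0::'g) H)"
proof -
  have H: "H \<subseteq> carrier (fundamental_group 0)"
    using assms(3) by (rule subgroup.subset)
  have "closedin (qtop_fundamental_group 0) H \<longleftrightarrow> avoids_small_loops 0 H"
    using closedin_qtop_imp_avoids_small_loops avoids_small_loops_imp_closedin_qtop[OF H] by blast
  moreover have "closedin (whisker_fundamental_group 0) H \<longleftrightarrow> avoids_small_loops 0 H"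
    by (rule closedin_whisker_iff_avoids_small_loops[OF H])
  moreover have "homotopically_Hausdorff_rel 0 H \<longleftrightarrow> avoids_small_loops 0 H"
    by (rule homotopically_Hausdorff_rel_iff_avoids_small_loops[OF assms(3)])
  moreover have "homotopically_path_Hausdorff_rel 0 H \<longleftrightarrow> avoids_small_loops 0 H"
    using avoids_small_loops_imp_homotopically_path_Hausdorff_rel
      homotopically_path_Hausdorff_rel_imp_avoids_small_loops by blast
  ultimately show ?thesis by blast
qed

end
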